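(* Let $\gamma_1,\gamma_2:[0,L]\to\mathbb{R}^2$ be two closed planar $C^2$ curves of the same arc length $L>0$, each parameterized by arc length $s$, with curvature functions $\kappa_1(s)$ and $\kappa_2(s)$. Suppose the curves are lined up, i.e. $\gamma_1(0)=\gamma_2(0)$ and the unit tangent and unit normal vectors of the two curves at $s=0$ coincide, so that the same constant vectors $C_1,C_2\in\mathbb{R}^2$ represent the Frenet frames of both curves: for $i=1,2$, $$\mathbf{T}_i(s)=\gamma_i'(s)=C_1\sin\Big(\int_0^s\kappa_i(\sigma)\,d\sigma\Big)-C_2\cos\Big(\int_0^s\kappa_i(\sigma)\,d\sigma\Big),$$ $$\mathbf{N}_i(s)=C_1\cos\Big(\int_0^s\kappa_i(\sigma)\,d\sigma\Big)+C_2\sin\Big(\int_0^s\kappa_i(\sigma)\,d\sigma\Big).$$ If $\sup_{s}|\kappa_1(s)-\kappa_2(s)|<\varepsilon$, then for every $s\in(0,L]$, setting $$\delta(\varepsilon)=s^2\varepsilon\,(\|C_1\|_2+\|C_2\|_2)>0,$$ one has $$\|\gamma_1(s)-\gamma_2(s)\|_2<\delta(\varepsilon).$$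
   Context: For a planar curve $\gamma$ parameterized by arc length $s$, $\mathbf{T}(s)=\gamma'(s)$ is the unit tangent, $\mathbf{N}(s)$ is the unit normal, and the (signed) curvature $\kappa(s)$ is determined by the planar Frenet-Serret equations $\mathbf{T}'=\kappa\mathbf{N}$, $\mathbf{N}'=-\kappa\mathbf{T}$. The general solution of this system is $\mathbf{T}=C_1\sin\int_0^s\kappa-C_2\cos\int_0^s\kappa$, $\mathbf{N}=C_1\cos\int_0^s\kappa+C_2\sin\int_0^s\kappa$, with constant vectors $C_1,C_2$ (so $C_1=\mathbf{N}(0)$ and $C_2=-\mathbf{T}(0)$). $\|\cdot\|_2$ is the Euclidean norm on $\mathbb{R}^2$. *)

theory Defs
  imports "HOL-Analysis.Analysis"
begin

text \<open>Curves are functions on \<open>{0..L}\<close>; all derivatives are taken within that interval, hence are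
  one-sided at the two endpoints.\<close>

definition curve_deriv :: "real \<Rightarrow> (real \<Rightarrow> real ^ 2) \<Rightarrow> real \<Rightarrow> real ^ 2" where
  "curve_deriv L \<gamma> s = vector_derivative \<gamma> (at s within {0..L})"

definition C2_curve :: "real \<Rightarrow> (real \<Rightarrow> real ^ 2) \<Rightarrow> bool" where
  "C2_curve L \<gamma> \<longleftrightarrow>
     \<gamma> differentiable_on {0..L} \<and>
     curve_deriv L \<gamma> differentiable_on {0..L} \<and>
     continuous_on {0..L} (curve_deriv L (curve_deriv L \<gamma>))"

definition arclength_parametrized :: "real \<Rightarrow> (real \<Rightarrow> real ^ 2) \<Rightarrow> bool" where
  "arclength_parametrized L \<gamma> \<longleftrightarrow> (\<forall>s\<in>{0..L}. norm (curve_deriv L \<gamma> s) = 1)"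

text \<open>Only the end points are required to agree; the derivatives at \<open>0\<close> and \<open>L\<close> need not.\<close>

definition closed_curve :: "real \<Rightarrow> (real \<Rightarrow> real ^ 2) \<Rightarrow> bool" where
  "closed_curve L \<gamma> \<longleftrightarrow> \<gamma> 0 = \<gamma> L"

text \<open>\<open>N\<close> is a unit normal field and \<open>\<kappa>\<close> the signed curvature of an arc-length parametrized curve
  \<open>\<gamma>\<close>. The orientation of the frame is left open: \<open>N\<close> is one of the two rotations of the tangent by
  a right angle, the same one on all of \<open>{0..L}\<close> by continuity, and exchanging them flips the sign of
  \<open>\<kappa>\<close>. Given \<open>N\<close>, the first Frenet-Serret equation determines \<open>\<kappa>\<close> on \<open>{0..L}\<close>.\<close>

definition frenet_apparatus ::
  "real \<Rightarrow> (real \<Rightarrow> real ^ 2) \<Rightarrow> (real \<Rightarrow> real ^ 2) \<Rightarrow> (real \<Rightarrow> real) \<Rightarrow> bool" where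
  "frenet_apparatus L \<gamma> N \<kappa> \<longleftrightarrow>
     (\<forall>s\<in>{0..L}.
        norm (N s) = 1 \<and> N s \<bullet> curve_deriv L \<gamma> s = 0 \<and>
        (curve_deriv L \<gamma> has_vector_derivative \<kappa> s *\<^sub>R N s) (at s within {0..L}) \<and>
        (N has_vector_derivative - \<kappa> s *\<^sub>R curve_deriv L \<gamma> s) (at s within {0..L}))"

definition frame_represented_by ::
  "real \<Rightarrow> (real \<Rightarrow> real ^ 2) \<Rightarrow> (real \<Rightarrow> real ^ 2) \<Rightarrow> (real \<Rightarrow> real) \<Rightarrow>
   real ^ 2 \<Rightarrow> real ^ 2 \<Rightarrow> bool" where
  "frame_represented_by L \<gamma> N \<kappa> C1 C2 \<longleftrightarrow>
     (\<forall>s\<in>{0..L}.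
        curve_deriv L \<gamma> s =
          sin (integral {0..s} \<kappa>) *\<^sub>R C1 - cos (integral {0..s} \<kappa>) *\<^sub>R C2 \<and>
        N s = cos (integral {0..s} \<kappa>) *\<^sub>R C1 + sin (integral {0..s} \<kappa>) *\<^sub>R C2)"

end

theory Submission
  imports Defs
begin

text \<open>Let \<open>\<theta> s\<close> be the integral of the curvature over \<open>{0..s}\<close>. The Frenet-Serret equations say that
  the frame turns with angular velocity \<open>\<kappa>\<close>, so turning it back by the angle \<open>\<theta>\<close> gives a frame with
  zero derivative, which is therefore the frame at \<open>0\<close>; solving for \<open>T\<close> and \<open>N\<close> gives the claimed
  representation (\<open>frenet_serret_solution\<close>). Continuity of \<open>\<kappa>\<close>, without which \<open>\<theta>\<close> need not be
  differentiable, comes from \<open>\<kappa> = N \<bullet> T'\<close> and the continuity of the second derivative of the curve.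

  For the estimate, let \<open>M\<close> be the supremum of \<open>\<bar>\<kappa>1 - \<kappa>2\<bar>\<close>. Integrating once, the angles differ at
  \<open>t\<close> by at most \<open>M * t\<close>. Sine and cosine are 1-Lipschitz, so by the common representation the
  tangents differ by at most \<open>M * t * (norm C1 + norm C2)\<close>. Integrating once more, the curves, which
  start at the same point, differ at \<open>s\<close> by at most \<open>M * s\<^sup>2 * (norm C1 + norm C2)\<close>. Replacing \<open>M\<close> by
  \<open>\<epsilon>\<close> makes the bound strict because \<open>s > 0\<close> and \<open>C1\<close> is a unit vector.\<close>

lemma abs_sin_diff_le: "\<bar>sin x - sin y\<bar> \<le> \<bar>x - y\<bar>" for x y :: real
proof -
  have "\<bar>sin x - sin y\<bar> = 2 * \<bar>sin ((x - y) / 2)\<bar> * \<bar>cos ((x + y) / 2)\<bar>"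
    by (simp add: sin_diff_sin abs_mult)
  also have "\<dots> \<le> 2 * \<bar>(x - y) / 2\<bar> * 1"
    by (intro mult_mono abs_sin_x_le_abs_x) auto
  finally show ?thesis by simp
qed

lemma abs_cos_diff_le: "\<bar>cos x - cos y\<bar> \<le> \<bar>x - y\<bar>" for x y :: real
  using abs_sin_diff_le[of "pi / 2 - x" "pi / 2 - y"]
  unfolding sin_cos_eq by (simp add: abs_minus_commute)
text \<open>\<open>A\<close> and \<open>B\<close> below are the frame \<open>(T, N)\<close> turned back by the accumulated angle \<open>\<theta>\<close>; the
  product rule makes their derivatives cancel.\<close>

lemma frenet_serret_solution:
  fixes T N :: "real \<Rightarrow> 'a::real_normed_vector" and \<kappa> :: "real \<Rightarrow> real"
  assumes \<kappa>: "continuous_on {0..L} \<kappa>"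
    and T: "\<And>s. s \<in> {0..L} \<Longrightarrow> (T has_vector_derivative \<kappa> s *\<^sub>R N s) (at s within {0..L})"
    and N: "\<And>s. s \<in> {0..L} \<Longrightarrow> (N has_vector_derivative - \<kappa> s *\<^sub>R T s) (at s within {0..L})"
    and s: "s \<in> {0..L}"
  shows "T s = sin (integral {0..s} \<kappa>) *\<^sub>R N 0 + cos (integral {0..s} \<kappa>) *\<^sub>R T 0"
    and "N s = cos (integral {0..s} \<kappa>) *\<^sub>R N 0 - sin (integral {0..s} \<kappa>) *\<^sub>R T 0"
proof -
  define \<theta> where "\<theta> s = integral {0..s} \<kappa>" for s
  define A where "A s = cos (\<theta> s) *\<^sub>R T s - sin (\<theta> s) *\<^sub>R N s" for s
  define B where "B s = sin (\<theta> s) *\<^sub>R T s + cos (\<theta> s) *\<^sub>R N s" for s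
  have \<theta>: "(\<theta> has_real_derivative \<kappa> t) (at t within {0..L})" if "t \<in> {0..L}" for t
    unfolding \<theta>_def using integral_has_real_derivative[OF \<kappa> that] .
  have sin_deriv: "((\<lambda>t. sin (\<theta> t)) has_real_derivative cos (\<theta> t) * \<kappa> t) (at t within {0..L})"
    if "t \<in> {0..L}" for t
    using DERIV_chain2[OF DERIV_sin \<theta>[OF that]] .
  have cos_deriv: "((\<lambda>t. cos (\<theta> t)) has_real_derivative - sin (\<theta> t) * \<kappa> t) (at t within {0..L})"
    if "t \<in> {0..L}" for t
    using DERIV_chain2[OF DERIV_cos \<theta>[OF that]] .
  have "(A has_vector_derivative 0) (at t within {0..L})" if t: "t \<in> {0..L}" for t
    unfolding A_def
    by (rule has_vector_derivative_eq_rhs[OF has_vector_derivative_diff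
        [OF has_vector_derivative_scaleR[OF cos_deriv[OF t] T[OF t]]
            has_vector_derivative_scaleR[OF sin_deriv[OF t] N[OF t]]]])
      (simp add: algebra_simps)
  then obtain c where "\<forall>t\<in>{0..L}. A t = c"
    using has_vector_derivative_zero_constant[of "{0..L}" A] by (metis convex_real_interval(5))
  then have "A s = A 0"
    using s by simp
  then have A: "A s = T 0" by (simp add: A_def \<theta>_def)
  have "(B has_vector_derivative 0) (at t within {0..L})" if t: "t \<in> {0..L}" for t
    unfolding B_def
    by (rule has_vector_derivative_eq_rhs[OF has_vector_derivative_add
        [OF has_vector_derivative_scaleR[OF sin_deriv[OF t] T[OF t]]
            has_vector_derivative_scaleR[OF cos_deriv[OF t] N[OF t]]]])
      (simp add: algebra_simps)
  then obtain c where "\<forall>t\<in>{0..L}. B t = c"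
    using has_vector_derivative_zero_constant[of "{0..L}" B] by (metis convex_real_interval(5))
  then have "B s = B 0"
    using s by simp
  then have B: "B s = N 0" by (simp add: B_def \<theta>_def)
  have sc: "sin (\<theta> s) * sin (\<theta> s) + cos (\<theta> s) * cos (\<theta> s) = 1"
    using sin_cos_squared_add[of "\<theta> s"] by (simp add: power2_eq_square)
  have "sin (\<theta> s) *\<^sub>R B s + cos (\<theta> s) *\<^sub>R A s
      = (sin (\<theta> s) * sin (\<theta> s)) *\<^sub>R T s + (cos (\<theta> s) * cos (\<theta> s)) *\<^sub>R T s"
    by (simp add: A_def B_def algebra_simps)
  also have "\<dots> = T s"
    using sc by (simp flip: scaleR_add_left)
  finally show "T s = sin (integral {0..s} \<kappa>) *\<^sub>R N 0 + cos (integral {0..s} \<kappa>) *\<^sub>R T 0"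
    by (simp add: A B flip: \<theta>_def)
  have "cos (\<theta> s) *\<^sub>R B s - sin (\<theta> s) *\<^sub>R A s
      = (sin (\<theta> s) * sin (\<theta> s)) *\<^sub>R N s + (cos (\<theta> s) * cos (\<theta> s)) *\<^sub>R N s"
    by (simp add: A_def B_def algebra_simps)
  also have "\<dots> = N s"
    using sc by (simp flip: scaleR_add_left)
  finally show "N s = cos (integral {0..s} \<kappa>) *\<^sub>R N 0 - sin (integral {0..s} \<kappa>) *\<^sub>R T 0"
    by (simp add: A B flip: \<theta>_def)
qed

text \<open>Since \<open>N\<close> has unit length, taking the inner product of the first Frenet-Serret equation with
  \<open>N\<close> isolates \<open>\<kappa>\<close>.\<close>

lemma continuous_on_curvature:
  assumes "L > 0" and C2: "C2_curve L \<gamma>" and fr: "frenet_apparatus L \<gamma> N \<kappa>"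
  shows "continuous_on {0..L} \<kappa>"
proof -
  have \<kappa>: "\<kappa> s = N s \<bullet> curve_deriv L (curve_deriv L \<gamma>) s" if s: "s \<in> {0..L}" for s
  proof -
    have "curve_deriv L (curve_deriv L \<gamma>) s = \<kappa> s *\<^sub>R N s"
      unfolding curve_deriv_def[of L "curve_deriv L \<gamma>"]
      using fr s by (intro vector_derivative_within_closed_interval[OF \<open>L > 0\<close>])
        (simp_all add: frenet_apparatus_def)
    moreover have "N s \<bullet> N s = 1"
      using fr s by (simp add: frenet_apparatus_def dot_square_norm)
    ultimately show ?thesis by simp
  qed
  have "continuous_on {0..L} N"
    using fr by (intro continuous_on_vector_derivative[of _ N "\<lambda>s. - \<kappa> s *\<^sub>R curve_deriv L \<gamma> s"])
      (simp add: frenet_apparatus_def)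
  then have "continuous_on {0..L} (\<lambda>s. N s \<bullet> curve_deriv L (curve_deriv L \<gamma>) s)"
    using C2 by (simp add: C2_curve_def continuous_on_inner)
  then show ?thesis
    by (rule continuous_on_eq) (simp add: \<kappa>)
qed

lemma frenet_apparatus_imp_represented:
  assumes "L > 0" "C2_curve L \<gamma>" and fr: "frenet_apparatus L \<gamma> N \<kappa>"
  shows "frame_represented_by L \<gamma> N \<kappa> (N 0) (- curve_deriv L \<gamma> 0)"
proof -
  have T: "(curve_deriv L \<gamma> has_vector_derivative \<kappa> s *\<^sub>R N s) (at s within {0..L})"
    and N: "(N has_vector_derivative - \<kappa> s *\<^sub>R curve_deriv L \<gamma> s) (at s within {0..L})"
    if "s \<in> {0..L}" for s
    using fr that by (simp_all add: frenet_apparatus_def)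
  note solution = frenet_serret_solution[OF continuous_on_curvature[OF assms] T N]
  show ?thesis
    unfolding frame_represented_by_def
  proof (intro ballI conjI)
    fix s assume s: "s \<in> {0..L}"
    show "curve_deriv L \<gamma> s = sin (integral {0..s} \<kappa>) *\<^sub>R N 0
        - cos (integral {0..s} \<kappa>) *\<^sub>R (- curve_deriv L \<gamma> 0)"
      using solution(1)[OF _ _ s] by simp
    show "N s = cos (integral {0..s} \<kappa>) *\<^sub>R N 0
        + sin (integral {0..s} \<kappa>) *\<^sub>R (- curve_deriv L \<gamma> 0)"
      using solution(2)[OF _ _ s] by simp
  qed
qed

lemma C2_curve_has_vector_derivative:
  assumes "C2_curve L \<gamma>" and "s \<in> {0..L}"
  shows "(\<gamma> has_vector_derivative curve_deriv L \<gamma> s) (at s within {0..L})"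
proof -
  have "\<gamma> differentiable at s within {0..L}"
    using assms by (simp add: C2_curve_def differentiable_on_def)
  then show ?thesis
    unfolding curve_deriv_def by (rule vector_derivative_works[THEN iffD1])
qed

lemma curve_deriv_diff_le:
  assumes rep1: "frame_represented_by L \<gamma>1 N1 \<kappa>1 C1 C2"
    and rep2: "frame_represented_by L \<gamma>2 N2 \<kappa>2 C1 C2"
    and cont1: "continuous_on {0..L} \<kappa>1" and cont2: "continuous_on {0..L} \<kappa>2"
    and M: "\<And>s. s \<in> {0..L} \<Longrightarrow> \<bar>\<kappa>1 s - \<kappa>2 s\<bar> \<le> M"
    and t: "t \<in> {0..L}"
  shows "norm (curve_deriv L \<gamma>1 t - curve_deriv L \<gamma>2 t) \<le> M * t * (norm C1 + norm C2)"
proof -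
  define a where "a = integral {0..t} \<kappa>1"
  define b where "b = integral {0..t} \<kappa>2"
  have c: "continuous_on {0..t} \<kappa>1" "continuous_on {0..t} \<kappa>2"
    using t by (auto intro: continuous_on_subset[OF cont1] continuous_on_subset[OF cont2])
  have "a - b = integral {0..t} (\<lambda>s. \<kappa>1 s - \<kappa>2 s)"
    unfolding a_def b_def using c by (simp add: integral_diff integrable_continuous_real)
  then have ab: "\<bar>a - b\<bar> \<le> M * t"
    using integral_bound[of 0 t "\<lambda>s. \<kappa>1 s - \<kappa>2 s" M] continuous_on_diff[OF c] M t by simp
  have "curve_deriv L \<gamma>1 t - curve_deriv L \<gamma>2 t
      = (sin a - sin b) *\<^sub>R C1 - (cos a - cos b) *\<^sub>R C2"
  proof -
    have "curve_deriv L \<gamma>1 t = sin a *\<^sub>R C1 - cos a *\<^sub>R C2"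
      using rep1 t unfolding frame_represented_by_def a_def by blast
    moreover have "curve_deriv L \<gamma>2 t = sin b *\<^sub>R C1 - cos b *\<^sub>R C2"
      using rep2 t unfolding frame_represented_by_def b_def by blast
    ultimately show ?thesis by (simp only: scaleR_left_diff_distrib) simp
  qed
  also have "norm \<dots> \<le> \<bar>sin a - sin b\<bar> * norm C1 + \<bar>cos a - cos b\<bar> * norm C2"
    using norm_triangle_ineq4[of "(sin a - sin b) *\<^sub>R C1" "(cos a - cos b) *\<^sub>R C2"] by simp
  also have "\<dots> \<le> (M * t) * norm C1 + (M * t) * norm C2"
    using ab abs_sin_diff_le[of a b] abs_cos_diff_le[of a b]
    by (intro add_mono mult_right_mono) auto
  finally show ?thesis by (simp add: algebra_simps)
qed

text \<open>Bounding the difference of the tangents on all of \<open>{0..s}\<close> by its bound at \<open>s\<close>, instead of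
  integrating the bound, costs a factor of 2 and still gives the constant that is needed.\<close>

lemma curve_diff_le:
  assumes "C2_curve L \<gamma>1" "C2_curve L \<gamma>2" and start: "\<gamma>1 0 = \<gamma>2 0"
    and rep: "frame_represented_by L \<gamma>1 N1 \<kappa>1 C1 C2" "frame_represented_by L \<gamma>2 N2 \<kappa>2 C1 C2"
    and cont: "continuous_on {0..L} \<kappa>1" "continuous_on {0..L} \<kappa>2"
    and M: "\<And>s. s \<in> {0..L} \<Longrightarrow> \<bar>\<kappa>1 s - \<kappa>2 s\<bar> \<le> M"
    and s: "s \<in> {0..L}"
  shows "norm (\<gamma>1 s - \<gamma>2 s) \<le> s\<^sup>2 * M * (norm C1 + norm C2)"
proof -
  define K where "K = norm C1 + norm C2"
  have K: "K \<ge> 0" by (simp add: K_def)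
  have M0: "M \<ge> 0" using M[OF s] by simp
  have "((\<lambda>t. \<gamma>1 t - \<gamma>2 t) has_vector_derivative curve_deriv L \<gamma>1 t - curve_deriv L \<gamma>2 t)
          (at t within {0..s})" if "t \<in> {0..s}" for t
    using that s assms(1,2)
    by (intro has_vector_derivative_diff has_vector_derivative_within_subset
          [OF C2_curve_has_vector_derivative, of L _ _ "{0..s}"]) auto
  then have "((\<lambda>t. curve_deriv L \<gamma>1 t - curve_deriv L \<gamma>2 t)
      has_integral (\<gamma>1 s - \<gamma>2 s) - (\<gamma>1 0 - \<gamma>2 0)) {0..s}"
    using fundamental_theorem_of_calculus[of 0 s "\<lambda>t. \<gamma>1 t - \<gamma>2 t"] s by simp
  then have int: "((\<lambda>t. curve_deriv L \<gamma>1 t - curve_deriv L \<gamma>2 t) has_integral \<gamma>1 s - \<gamma>2 s) {0..s}"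
    using start by simp
  have "norm (curve_deriv L \<gamma>1 t - curve_deriv L \<gamma>2 t) \<le> M * s * K" if t: "t \<in> {0..s}" for t
  proof -
    have "norm (curve_deriv L \<gamma>1 t - curve_deriv L \<gamma>2 t) \<le> M * t * K"
      unfolding K_def using curve_deriv_diff_le[OF rep cont M] t s by simp
    also have "\<dots> \<le> M * s * K"
      using t K M0 by (intro mult_right_mono mult_left_mono) auto
    finally show ?thesis .
  qed
  then have "norm (\<gamma>1 s - \<gamma>2 s) \<le> M * s * K * measure lborel {0..s}"
    using s K M0 by (intro has_integral_bound_real[OF _ _ int, of _ "{}"]) auto
  also have "\<dots> = s\<^sup>2 * M * K"
    using s by (simp add: power2_eq_square)
  finally show ?thesis unfolding K_def .
qed

theorem theorem3p4:
  fixes L :: real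
    and \<gamma>1 \<gamma>2 N1 N2 :: "real \<Rightarrow> real ^ 2"
    and \<kappa>1 \<kappa>2 :: "real \<Rightarrow> real"
    and C1 C2 :: "real ^ 2"
  assumes "L > 0"
    and "C2_curve L \<gamma>1" and "C2_curve L \<gamma>2"
    and "closed_curve L \<gamma>1" and "closed_curve L \<gamma>2"
    and "arclength_parametrized L \<gamma>1" and "arclength_parametrized L \<gamma>2"
    and "frenet_apparatus L \<gamma>1 N1 \<kappa>1" and "frenet_apparatus L \<gamma>2 N2 \<kappa>2"
    and "\<gamma>1 0 = \<gamma>2 0"
    and "curve_deriv L \<gamma>1 0 = curve_deriv L \<gamma>2 0"
    and "N1 0 = N2 0"
    and "C1 = N1 0" and "C2 = - curve_deriv L \<gamma>1 0"
  shows "frame_represented_by L \<gamma>1 N1 \<kappa>1 C1 C2 \<and>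
         frame_represented_by L \<gamma>2 N2 \<kappa>2 C1 C2 \<and>
         (\<forall>\<epsilon>::real. (SUP s\<in>{0..L}. \<bar>\<kappa>1 s - \<kappa>2 s\<bar>) < \<epsilon> \<longrightarrow>
            (\<forall>s\<in>{0<..L}.
               let \<delta> = s\<^sup>2 * \<epsilon> * (norm C1 + norm C2)
               in \<delta> > 0 \<and> norm (\<gamma>1 s - \<gamma>2 s) < \<delta>))"
proof -
  have cont: "continuous_on {0..L} \<kappa>1" "continuous_on {0..L} \<kappa>2"
    using continuous_on_curvature assms by blast+
  have rep: "frame_represented_by L \<gamma>1 N1 \<kappa>1 C1 C2" "frame_represented_by L \<gamma>2 N2 \<kappa>2 C1 C2"
    using frenet_apparatus_imp_represented[of L \<gamma>1 N1 \<kappa>1]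
      frenet_apparatus_imp_represented[of L \<gamma>2 N2 \<kappa>2] assms by simp_all
  have K: "norm C1 + norm C2 > 0"
    using assms(1,8,13) by (simp add: frenet_apparatus_def add_pos_nonneg)
  define M where "M = (SUP s\<in>{0..L}. \<bar>\<kappa>1 s - \<kappa>2 s\<bar>)"
  \<comment> \<open>The supremum of an unbounded set is an unspecified real; continuity on the compact interval
    rules that out.\<close>
  have "bdd_above ((\<lambda>s. \<bar>\<kappa>1 s - \<kappa>2 s\<bar>) ` {0..L})"
    using cont by (intro bounded_imp_bdd_above compact_imp_bounded compact_continuous_image
        continuous_intros) auto
  then have M: "\<bar>\<kappa>1 s - \<kappa>2 s\<bar> \<le> M" if "s \<in> {0..L}" for s
    unfolding M_def using that by (rule cSUP_upper2) auto
  have M0: "M \<ge> 0"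
    using M[of 0] \<open>L > 0\<close> by simp
  have "s\<^sup>2 * \<epsilon> * (norm C1 + norm C2) > 0 \<and>
      norm (\<gamma>1 s - \<gamma>2 s) < s\<^sup>2 * \<epsilon> * (norm C1 + norm C2)"
    if "M < \<epsilon>" and s: "s \<in> {0<..L}" for \<epsilon> s
  proof
    show "s\<^sup>2 * \<epsilon> * (norm C1 + norm C2) > 0"
      using that M0 K by simp
    have "norm (\<gamma>1 s - \<gamma>2 s) \<le> s\<^sup>2 * M * (norm C1 + norm C2)"
      using curve_diff_le[OF assms(2,3,10) rep cont M] s by simp
    also have "\<dots> < s\<^sup>2 * \<epsilon> * (norm C1 + norm C2)"
      using that K by (intro mult_strict_right_mono mult_strict_left_mono) auto
    finally show "norm (\<gamma>1 s - \<gamma>2 s) < s\<^sup>2 * \<epsilon> * (norm C1 + norm C2)" .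
  qed
  then show ?thesis
    using rep unfolding M_def[symmetric] Let_def by blast
qed

end
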